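(* Let $p$ be an odd prime. If $p\equiv1\pmod4$, write $p=x^2+4y^2$ with $x,y\in\mathbb{Z}$ and $x\equiv1\pmod4$; then $$\sum_{n=0}^{p-1}\frac{G_n}{(-16)^n}\equiv(-1)^{\frac{p-1}{4}}\sum_{n=0}^{p-1}\frac{G_n}{8^n}\equiv(-1)^{\frac{p-1}{4}}\sum_{n=0}^{p-1}\frac{G_n}{32^n}\equiv 2x\pmod p.$$ If $p\equiv3\pmod4$, then each of $\sum_{n=0}^{p-1}\frac{G_n}{(-16)^n}$, $\sum_{n=0}^{p-1}\frac{G_n}{8^n}$, $\sum_{n=0}^{p-1}\frac{G_n}{32^n}$ is $\equiv0\pmod p$.
   Context: For $n\ge0$, $G_n=\sum_{k=0}^n \binom{2k}{k}^2\binom{2n-2k}{n-k}4^{n-k}$. Congruences between rationals with denominators prime to $p$ are taken in the ring of such rationals. *)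

theory Defs
  imports "HOL-Number_Theory.Number_Theory"
begin

definition G :: "nat \<Rightarrow> nat" where
  "G n = (\<Sum>k=0..n. ((2 * k) choose k)\<^sup>2 * ((2 * n - 2 * k) choose (n - k)) * 4 ^ (n - k))"

(* quotient_of returns the numerator and the (positive) denominator in lowest terms. *)
definition local_ints :: "nat \<Rightarrow> rat set" where
  "local_ints p = {r. coprime (snd (quotient_of r)) (int p)}"

(* Congruence modulo the ideal generated by p in local_ints p, not in rat, where p is a unit. *)
definition local_cong :: "nat \<Rightarrow> rat \<Rightarrow> rat \<Rightarrow> bool" where
  "local_cong p a b \<longleftrightarrow>
     a \<in> local_ints p \<and> b \<in> local_ints p \<and> (\<exists>c\<in>local_ints p. a - b = of_nat p * c)"

definition G_sum :: "nat \<Rightarrow> rat \<Rightarrow> rat" where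
  "G_sum p m = (\<Sum>n=0..p-1. of_nat (G n) / m ^ n)"

end

theory Submission
  imports Defs "HOL-Computational_Algebra.Polynomial"
begin

text \<open>
  Put \<open>p = 2m + 1\<close>. Modulo \<open>p\<close>, \<open>(2k choose k) = (-4)^k (m choose k)\<close> for \<open>k < p\<close>, so the
  convolution defining \<open>G\<close> has no terms beyond degree \<open>2m = p - 1\<close> and its truncated generating function
  factors as \<open>S(16 z) (1 - 16 z)^m\<close> with \<open>S(x) = \<Sum>k. (m choose k)\<^sup>2 x^k\<close>. The three
  sums lead to \<open>S(-1)\<close>, \<open>S(2)\<close> and \<open>S(1/2)\<close>. The last two agree up to a power of 2, and
  \<open>S(2) = \<Sum>j. (m choose j) (m + j choose j)\<close> is congruent to \<open>S(-1)\<close>, which is \<open>0\<close> for odd \<open>m\<close>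
  and \<open>(-1)^f (2f choose f)\<close> for \<open>m = 2f\<close>.

  For \<open>p = 4f + 1 = x\<^sup>2 + 4y\<^sup>2\<close>, Gauss's congruence \<open>(2f choose f) = 2x\<close> comes from the Jacobsthal sums
  \<open>J(a) = \<Sum>t. (t/p) ((t\<^sup>2 + a)/p)\<close>, which satisfy \<open>J(-1)\<^sup>2 + J(n)\<^sup>2 = 4p\<close> for a nonresidue \<open>n\<close>,
  while expanding Euler's criterion gives \<open>J(-1) = - (-1)^f (2f choose f)\<close> modulo \<open>p\<close>.
\<close>

section \<open>Sums of squared binomial coefficients\<close>

text \<open>In terms of the Legendre polynomial \<open>P_m\<close> this is
  \<open>(1 - x)^m P_m((1 + x) / (1 - x))\<close>. The argument is an integer so that inverses
  modulo \<open>p\<close> can be substituted for it.\<close>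

definition sq_binom_sum :: "nat \<Rightarrow> int \<Rightarrow> int" where
  "sq_binom_sum m x = (\<Sum>k\<le>m. (int (m choose k))\<^sup>2 * x ^ k)"

section \<open>Binomial coefficients modulo p\<close>

lemma coprime_int_Suc_prime:
  assumes "prime p" and "Suc k < p"
  shows "coprime (int (Suc k)) (int p)"
proof -
  have "\<not> p dvd Suc k" using assms(2) by (auto dest: dvd_imp_le)
  then have "coprime p (Suc k)" using assms(1) prime_imp_coprime by blast
  then show ?thesis by (simp only: coprime_int_iff coprime_commute)
qed

text \<open>Over the integers the recursion holds for every \<open>k\<close>, also past
  \<open>m\<close>, where both binomials vanish. The inductions below run over all
  \<open>k < p\<close> and need that range.\<close>

lemma Suc_times_binomial_Suc_int:
  "int (Suc k) * int (m choose Suc k) = (int m - int k) * int (m choose k)"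
proof (cases "k \<le> m")
  case True
  then have "int (Suc k * (m choose Suc k)) = int ((m - k) * (m choose k))"
    by (metis binomial_absorb_comp binomial_absorption mult.commute)
  then show ?thesis
    using True by (simp only: of_nat_mult of_nat_diff)
next
  case False
  then have "m choose k = 0" "m choose Suc k = 0" by simp_all
  then show ?thesis by (simp only: of_nat_0 mult_zero_right)
qed

text \<open>Both sides satisfy the same first-order recursion modulo \<open>p\<close>, and its
  leading factor \<open>Suc k\<close> is a unit there. For \<open>m < k < p\<close> the right side
  is 0, matching the factor \<open>p\<close> in the central binomial.\<close>

lemma cong_central_binomial:
  assumes p: "prime p" "p = 2 * m + 1" and "k < p"
  shows "[int ((2 * k) choose k) = (- 4) ^ k * int (m choose k)] (mod int p)"
  using \<open>k < p\<close>
proof (induction k)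
  case 0
  then show ?case by simp
next
  case (Suc k)
  have "Suc k * ((2 * Suc k) choose Suc k) = 2 * (Suc k * ((2 * k + 1) choose k))"
    using Suc_times_binomial[of k "2 * k + 1"] by simp
  also have "(2 * k + 1) choose k = (2 * k + 1) choose Suc k"
    using binomial_symmetric[of k "2 * k + 1"] by simp
  also have "Suc k * ((2 * k + 1) choose Suc k) = (2 * k + 1) * ((2 * k) choose k)"
    using Suc_times_binomial[of k "2 * k"] by simp
  finally have "Suc k * ((2 * Suc k) choose Suc k) = 2 * (2 * k + 1) * ((2 * k) choose k)"
    by (simp only: mult.assoc)
  from arg_cong[OF this, of int]
  have A: "int (Suc k) * int ((2 * Suc k) choose Suc k) = 2 * (2 * int k + 1) * int ((2 * k) choose k)"
    by (simp only: of_nat_mult of_nat_add of_nat_1 of_nat_numeral)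
  have B: "int (Suc k) * ((- 4) ^ Suc k * int (m choose Suc k))
      = (4 * int k - 4 * int m) * ((- 4) ^ k * int (m choose k))"
    unfolding mult.left_commute[of "int (Suc k)"] Suc_times_binomial_Suc_int
    by (simp add: algebra_simps)
  \<comment> \<open>The difference of the two sides is \<open>4 * m + 2\<close>, that is
    \<open>2 * p\<close>.\<close>
  have "[2 * (2 * int k + 1) = 4 * int k - 4 * int m] (mod int p)"
    using p(2) by (auto simp: cong_iff_dvd_diff intro!: dvdI[of _ _ 2])
  moreover have "[int ((2 * k) choose k) = (- 4) ^ k * int (m choose k)] (mod int p)"
    using Suc by simp
  ultimately have "[int (Suc k) * int ((2 * Suc k) choose Suc k)
      = int (Suc k) * ((- 4) ^ Suc k * int (m choose Suc k))] (mod int p)"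
    unfolding A B by (rule cong_mult)
  then show ?case
    using cong_mult_lcancel[OF coprime_int_Suc_prime[OF p(1) Suc.prems]] by blast
qed

text \<open>Again a comparison of recursions: the factors \<open>m + k + 1\<close> and
  \<open>k - m\<close> differ by \<open>2 * m + 1 = p\<close>.\<close>

lemma cong_binomial_reflect:
  assumes p: "prime p" "p = 2 * m + 1" and "k < p"
  shows "[int ((m + k) choose k) = (- 1) ^ k * int (m choose k)] (mod int p)"
  using \<open>k < p\<close>
proof (induction k)
  case 0
  then show ?case by simp
next
  case (Suc k)
  have "Suc k * ((m + Suc k) choose Suc k) = (m + k + 1) * ((m + k) choose k)"
    using Suc_times_binomial[of k "m + k"] by simp
  from arg_cong[OF this, of int]
  have A: "int (Suc k) * int ((m + Suc k) choose Suc k) = (int m + int k + 1) * int ((m + k) choose k)"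
    by (simp only: of_nat_mult of_nat_add of_nat_1)
  have B: "int (Suc k) * ((- 1) ^ Suc k * int (m choose Suc k))
      = (int k - int m) * ((- 1) ^ k * int (m choose k))"
    unfolding mult.left_commute[of "int (Suc k)"] Suc_times_binomial_Suc_int
    by (simp add: algebra_simps)
  have "int m + int k + 1 - (int k - int m) = int p"
    using p(2) by simp
  then have "[int m + int k + 1 = int k - int m] (mod int p)"
    unfolding cong_iff_dvd_diff by simp
  moreover have "[int ((m + k) choose k) = (- 1) ^ k * int (m choose k)] (mod int p)"
    using Suc by simp
  ultimately have "[int (Suc k) * int ((m + Suc k) choose Suc k)
      = int (Suc k) * ((- 1) ^ Suc k * int (m choose Suc k))] (mod int p)"
    unfolding A B by (rule cong_mult)
  then show ?case
    using cong_mult_lcancel[OF coprime_int_Suc_prime[OF p(1) Suc.prems]] by blast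
qed

text \<open>Here \<open>x\<close> plays the role of the inverse of the base -16, 8 or 32, so that
  the whole computation stays in the integers.\<close>

lemma cong_G_sum_factor:
  assumes p: "prime p" "p = 2 * m + 1"
  shows "[(\<Sum>n=0..p - 1. int (G n) * x ^ n)
          = sq_binom_sum m (16 * x) * (1 - 16 * x) ^ m] (mod int p)"
proof -
  define a where "a k = 16 ^ k * (int (m choose k))\<^sup>2" for k
  define b where "b k = (- 16) ^ k * int (m choose k)" for k
  have a: "[(int ((2 * k) choose k))\<^sup>2 = a k] (mod int p)" if "k < p" for k
  proof -
    have "((- 4) ^ k)\<^sup>2 = (16 :: int) ^ k"
      by (simp add: power2_eq_square flip: power_mult_distrib)
    then show ?thesis
      using cong_pow[OF cong_central_binomial[OF p that], of 2]
      by (simp only: a_def power_mult_distrib)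
  qed
  have b: "[int ((2 * k) choose k) * 4 ^ k = b k] (mod int p)" if "k < p" for k
    using cong_scalar_right[OF cong_central_binomial[OF p that], of "4 ^ k"]
    by (simp add: b_def mult_ac flip: power_mult_distrib)
  have G: "[int (G n) = (\<Sum>k\<le>n. a k * b (n - k))] (mod int p)" if "n < p" for n
  proof -
    have "int (G n) = (\<Sum>k\<le>n. (int ((2 * k) choose k))\<^sup>2 * (int ((2 * (n - k)) choose (n - k)) * 4 ^ (n - k)))"
      by (simp add: G_def atLeast0AtMost mult.assoc flip: diff_mult_distrib2)
    also have "[\<dots> = (\<Sum>k\<le>n. a k * b (n - k))] (mod int p)"
      using that by (intro cong_sum cong_mult a b) auto
    finally show ?thesis .
  qed
  have "[(\<Sum>n=0..p - 1. int (G n) * x ^ n) = (\<Sum>n=0..p - 1. (\<Sum>k\<le>n. a k * b (n - k)) * x ^ n)] (mod int p)"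
    using p(2) by (intro cong_sum cong_mult G cong_refl) auto
  \<comment> \<open>Since \<open>p - 1 = 2 * m\<close>, the truncation at \<open>p - 1\<close> keeps
    exactly the degrees of a product of two polynomials of degree \<open>m\<close>; \<open>a\<close>
    and \<open>b\<close> vanish beyond \<open>m\<close>.\<close>
  also have "(\<Sum>n=0..p - 1. (\<Sum>k\<le>n. a k * b (n - k)) * x ^ n)
      = (\<Sum>n\<le>m + m. (\<Sum>k\<le>n. a k * b (n - k)) * x ^ n)"
    using p(2) by (simp add: atLeast0AtMost mult_2)
  also have "\<dots> = (\<Sum>k\<le>m. a k * x ^ k) * (\<Sum>k\<le>m. b k * x ^ k)"
    by (rule polynomial_product[symmetric]) (simp_all add: a_def b_def)
  also have "(\<Sum>k\<le>m. a k * x ^ k) = sq_binom_sum m (16 * x)"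
    unfolding sq_binom_sum_def a_def power_mult_distrib by (simp only: mult_ac)
  also have "(\<Sum>k\<le>m. b k * x ^ k) = (\<Sum>k\<le>m. of_nat (m choose k) * (- 16 * x) ^ k * 1 ^ (m - k))"
    unfolding b_def power_mult_distrib by (simp only: power_one mult_1_right mult_1_left mult_ac)
  also have "\<dots> = (- 16 * x + 1) ^ m"
    by (rule binomial_ring[symmetric])
  finally show ?thesis by simp
qed

section \<open>Values of the sum of squared binomials at -1, 2 and an inverse\<close>

lemma sq_binom_sum_cong:
  "[x = y] (mod q) \<Longrightarrow> [sq_binom_sum m x = sq_binom_sum m y] (mod q)"
  unfolding sq_binom_sum_def by (intro cong_sum cong_mult cong_pow cong_refl)

text \<open>Read off the coefficient of \<open>X^m\<close> in
  \<open>(1 - X)^m (1 + X)^m = (1 - X^2)^m\<close>, which has only even powers.\<close>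

lemma sq_binom_sum_minus_one:
  "sq_binom_sum m (- 1) = (if even m then (- 1) ^ (m div 2) * int (m choose (m div 2)) else 0)"
proof -
  have "sq_binom_sum m (- 1) = coeff ([:1, -1:] ^ m * [:1, 1:] ^ m) m"
    unfolding coeff_mult sq_binom_sum_def
    by (intro sum.cong refl)
      (simp add: coeff_linear_poly_power power2_eq_square mult_ac flip: binomial_symmetric)
  also have "[:1, -1:] ^ m * [:1, 1:] ^ m = (monom (- 1) 2 + 1 :: int poly) ^ m"
    unfolding power_mult_distrib[symmetric]
    by (simp add: monom_altdef power2_eq_square one_pCons)
  also have "\<dots> = (\<Sum>k\<le>m. monom (int (m choose k) * (- 1) ^ k) (2 * k))"
    unfolding binomial_ring
    by (intro sum.cong refl) (simp add: monom_power of_nat_monom mult_monom)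
  also have "coeff \<dots> m = (\<Sum>k\<le>m. if k = m div 2 then (if even m then int (m choose k) * (- 1) ^ k else 0) else 0)"
    unfolding coeff_sum by (intro sum.cong refl) auto
  also have "\<dots> = (if even m then (- 1) ^ (m div 2) * int (m choose (m div 2)) else 0)"
    by simp
  finally show ?thesis .
qed

text \<open>Both sides are central Delannoy numbers.\<close>

lemma sq_binom_sum_two:
  "sq_binom_sum m 2 = (\<Sum>j\<le>m. int (m choose j) * int ((m + j) choose j))"
proof -
  have inner: "(\<Sum>k=j..m. (m choose k) * ((m - j) choose (k - j))) = (m + (m - j)) choose (m - j)"
    if "j \<le> m" for j
  proof -
    have "(\<Sum>k=j..m. (m choose k) * ((m - j) choose (k - j)))
        = (\<Sum>i\<le>m - j. (m choose i) * ((m - j) choose (m - j - i)))"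
      by (rule sum.reindex_bij_witness[of _ "\<lambda>i. m - i" "\<lambda>k. m - k"])
        (use that in \<open>auto simp flip: binomial_symmetric\<close>)
    also have "\<dots> = (m + (m - j)) choose (m - j)"
      by (rule vandermonde)
    finally show ?thesis .
  qed
  have "(\<Sum>k\<le>m. (m choose k)\<^sup>2 * 2 ^ k)
      = (\<Sum>k\<le>m. \<Sum>j\<le>k. (m choose j) * ((m choose k) * ((m - j) choose (k - j))))"
  proof (intro sum.cong refl)
    fix k assume "k \<in> {..m}"
    \<comment> \<open>Write \<open>2^k\<close> as a row sum of binomials and regroup
      \<open>(m choose k) (k choose j)\<close> as \<open>(m choose j) (m - j choose k - j)\<close>.
      After the sums are exchanged, \<open>inner\<close> evaluates the sum over \<open>k\<close> by
      Vandermonde.\<close>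
    have "(m choose k)\<^sup>2 * 2 ^ k = (\<Sum>j\<le>k. (m choose k)\<^sup>2 * (k choose j))"
      by (simp add: choose_row_sum flip: sum_distrib_left)
    also have "\<dots> = (\<Sum>j\<le>k. (m choose j) * ((m choose k) * ((m - j) choose (k - j))))"
      using \<open>k \<in> {..m}\<close> choose_mult[of _ k m]
      by (intro sum.cong refl) (simp add: power2_eq_square)
    finally show "(m choose k)\<^sup>2 * 2 ^ k
      = (\<Sum>j\<le>k. (m choose j) * ((m choose k) * ((m - j) choose (k - j))))" .
  qed
  also have "\<dots> = (\<Sum>j\<le>m. \<Sum>k=j..m. (m choose j) * ((m choose k) * ((m - j) choose (k - j))))"
    by (subst sum.Sigma, simp, simp, subst sum.Sigma, simp, simp,
        rule sum.reindex_bij_witness[of _ "\<lambda>(j, k). (k, j)" "\<lambda>(k, j). (j, k)"]) auto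
  also have "\<dots> = (\<Sum>j\<le>m. (m choose j) * ((m + (m - j)) choose (m - j)))"
    by (intro sum.cong refl) (simp add: inner flip: sum_distrib_left)
  also have "\<dots> = (\<Sum>j\<le>m. (m choose j) * ((m + j) choose j))"
    by (rule sum.reindex_bij_witness[of _ "\<lambda>i. m - i" "\<lambda>k. m - k"])
      (auto simp flip: binomial_symmetric)
  finally have "int (\<Sum>k\<le>m. (m choose k)\<^sup>2 * 2 ^ k) = int (\<Sum>j\<le>m. (m choose j) * ((m + j) choose j))"
    by simp
  then show ?thesis by (simp add: sq_binom_sum_def)
qed

text \<open>The congruence holds term by term: reflecting \<open>(m + k) choose k\<close> produces
  the second factor \<open>m choose k\<close> and the sign.\<close>

lemma sq_binom_sum_two_cong:
  assumes p: "prime p" "p = 2 * m + 1"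
  shows "[sq_binom_sum m 2 = sq_binom_sum m (- 1)] (mod int p)"
  unfolding sq_binom_sum_two unfolding sq_binom_sum_def
proof (rule cong_sum)
  fix k assume "k \<in> {..m}"
  then have "[int (m choose k) * int ((m + k) choose k)
      = int (m choose k) * ((- 1) ^ k * int (m choose k))] (mod int p)"
    using p(2) by (intro cong_mult cong_refl cong_binomial_reflect[OF p]) auto
  then show "[int (m choose k) * int ((m + k) choose k) = (int (m choose k))\<^sup>2 * (- 1) ^ k] (mod int p)"
    by (simp add: power2_eq_square mult_ac)
qed

text \<open>The coefficients are palindromic, so multiplication by \<open>y ^ m\<close> reverses the
  polynomial. This will link the values at 2 and at its inverse.\<close>

lemma sq_binom_sum_inverse:
  assumes "[x * y = 1] (mod q)"
  shows "[sq_binom_sum m x * y ^ m = sq_binom_sum m y] (mod q)"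
proof -
  have "[(\<Sum>k\<le>m. (int (m choose k))\<^sup>2 * x ^ k * y ^ m)
      = (\<Sum>k\<le>m. (int (m choose (m - k)))\<^sup>2 * y ^ (m - k))] (mod q)"
  proof (rule cong_sum)
    fix k assume k: "k \<in> {..m}"
    then have "y ^ m = y ^ k * y ^ (m - k)" by (simp flip: power_add)
    then have "(int (m choose k))\<^sup>2 * x ^ k * y ^ m = (int (m choose k))\<^sup>2 * y ^ (m - k) * (x * y) ^ k"
      by (simp add: power_mult_distrib mult_ac)
    also have "[\<dots> = (int (m choose k))\<^sup>2 * y ^ (m - k) * 1 ^ k] (mod q)"
      by (intro cong_mult cong_refl cong_pow assms)
    finally show "[(int (m choose k))\<^sup>2 * x ^ k * y ^ m = (int (m choose (m - k)))\<^sup>2 * y ^ (m - k)] (mod q)"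
      using k by (simp flip: binomial_symmetric)
  qed
  also have "(\<Sum>k\<le>m. (int (m choose (m - k)))\<^sup>2 * y ^ (m - k)) = sq_binom_sum m y"
    unfolding sq_binom_sum_def
    by (rule sum.reindex_bij_witness[of _ "\<lambda>i. m - i" "\<lambda>k. m - k"]) auto
  finally show ?thesis by (simp add: sq_binom_sum_def sum_distrib_right)
qed

section \<open>Legendre symbol sums\<close>

locale odd_prime_modulus =
  fixes p :: nat
  assumes prime_p: "prime p" and p_gt_2: "2 < p"
begin

abbreviation \<chi> :: "int \<Rightarrow> int" where "\<chi> x \<equiv> Legendre x (int p)"

abbreviation R :: "int set" where "R \<equiv> {0..<int p}"

lemma prime_int_p: "prime (int p)"
  using prime_p by simp

lemma cong_R_eq:
  assumes "[x = y] (mod int p)" "x \<in> R" "y \<in> R"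
  shows "x = y"
  using assms by (simp add: cong_def)

lemma Legendre_cong:
  assumes "[x = y] (mod int p)"
  shows "\<chi> x = \<chi> y"
proof -
  have "[x = 0] (mod int p) = [y = 0] (mod int p)"
    using assms cong_trans cong_sym by blast
  moreover have "QuadRes (int p) x = QuadRes (int p) y"
    unfolding QuadRes_def using assms cong_trans cong_sym by blast
  ultimately show ?thesis by (simp add: Legendre_def)
qed

lemma Legendre_eq_0_iff: "\<chi> x = 0 \<longleftrightarrow> int p dvd x"
  by (simp add: Legendre_def cong_0_iff)

lemma Legendre_cases: "\<chi> x = 0 \<or> \<chi> x = 1 \<or> \<chi> x = - 1"
  by (simp add: Legendre_def)

lemma Legendre_square: "(\<chi> x)\<^sup>2 = (if int p dvd x then 0 else 1)"
  using Legendre_cases[of x] Legendre_eq_0_iff[of x] by auto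

lemma cong_Legendre: "[\<chi> x = x ^ ((p - 1) div 2)] (mod int p)"
proof (cases "int p dvd x")
  case True
  then have "int p dvd x ^ ((p - 1) div 2)"
    using p_gt_2 by (auto intro: dvd_power dvd_trans)
  with True show ?thesis
    by (simp add: cong_iff_dvd_diff Legendre_eq_0_iff[THEN iffD2])
next
  case False
  then show ?thesis
    using euler_criterion[OF prime_p p_gt_2] by (simp add: cong_0_iff)
qed

text \<open>Such numbers are at most 2 apart and \<open>p > 2\<close>. This upgrades congruences
  from Euler's criterion to equalities of Legendre symbols.\<close>

lemma cong_small_eq:
  assumes "[a = b] (mod int p)" and "\<bar>a\<bar> \<le> 1" and "\<bar>b\<bar> \<le> 1"
  shows "a = b"
proof (rule ccontr)
  assume "a \<noteq> b"
  moreover have "int p dvd a - b" using assms(1) by (simp add: cong_iff_dvd_diff)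
  ultimately have "int p \<le> \<bar>a - b\<bar>" using dvd_imp_le_int[of "a - b" "int p"] by simp
  then show False using assms p_gt_2 by linarith
qed

lemma Legendre_mult: "\<chi> (x * y) = \<chi> x * \<chi> y"
proof (rule cong_small_eq)
  have "[\<chi> (x * y) = x ^ ((p - 1) div 2) * y ^ ((p - 1) div 2)] (mod int p)"
    using cong_Legendre[of "x * y"] by (simp add: power_mult_distrib)
  also have "[x ^ ((p - 1) div 2) * y ^ ((p - 1) div 2) = \<chi> x * \<chi> y] (mod int p)"
    by (intro cong_mult cong_Legendre[THEN cong_sym])
  finally show "[\<chi> (x * y) = \<chi> x * \<chi> y] (mod int p)" .
  show "\<bar>\<chi> (x * y)\<bar> \<le> 1" "\<bar>\<chi> x * \<chi> y\<bar> \<le> 1"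
    using Legendre_cases[of x] Legendre_cases[of y] Legendre_cases[of "x * y"] by auto
qed

lemma Legendre_1: "\<chi> 1 = 1"
  by (rule cong_small_eq) (use cong_Legendre[of 1] Legendre_cases[of 1] in auto)

lemma Legendre_of_square: "\<not> int p dvd t \<Longrightarrow> \<chi> (t\<^sup>2) = 1"
  using Legendre_mult[of t t] Legendre_square[of t] by (simp add: power2_eq_square)

lemma Legendre_eq_1D:
  assumes "\<chi> x = 1"
  obtains t where "[t\<^sup>2 = x] (mod int p)" and "\<not> int p dvd t"
proof -
  from assms have "QuadRes (int p) x" "\<not> int p dvd x"
    by (auto simp: Legendre_def cong_0_iff split: if_splits)
  then obtain t where t: "[t\<^sup>2 = x] (mod int p)" by (auto simp: QuadRes_def)
  moreover have "\<not> int p dvd t"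
  proof
    assume "int p dvd t"
    then have "int p dvd t\<^sup>2" by (simp add: power2_eq_square)
    then show False using t \<open>\<not> int p dvd x\<close> cong_dvd_iff by blast
  qed
  ultimately show thesis using that by blast
qed

section \<open>Changes of variable in sums over all residues\<close>

lemma sum_residues_reindex:
  fixes h :: "int \<Rightarrow> 'a :: comm_monoid_add"
  assumes h: "\<And>x y. [x = y] (mod int p) \<Longrightarrow> h x = h y"
    and inj: "\<And>x y. [g x = g y] (mod int p) \<Longrightarrow> [x = y] (mod int p)"
  shows "(\<Sum>x\<in>R. h (g x)) = (\<Sum>x\<in>R. h x)"
proof -
  \<comment> \<open>\<open>g\<close> itself may leave \<open>R\<close>; its reduction is an
    injective self-map of the finite set \<open>R\<close>, hence a permutation, and \<open>h\<close>
    does not see the reduction.\<close>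
  let ?g = "\<lambda>x. g x mod int p"
  have "inj_on ?g R"
  proof (rule inj_onI)
    fix x y assume "x \<in> R" "y \<in> R" "g x mod int p = g y mod int p"
    then show "x = y" using inj[of x y] cong_R_eq[of x y] unfolding cong_def by blast
  qed
  moreover have "?g ` R \<subseteq> R"
    using p_gt_2 by auto
  ultimately have bij: "bij_betw ?g R R"
    by (simp add: bij_betw_def endo_inj_surj)
  have "(\<Sum>x\<in>R. h (g x)) = (\<Sum>x\<in>R. h (?g x))"
    by (intro sum.cong refl h) (simp add: cong_def)
  also have "\<dots> = (\<Sum>x\<in>R. h x)"
    by (rule sum.reindex_bij_betw[OF bij])
  finally show ?thesis .
qed

lemma sum_residues_shift:
  fixes h :: "int \<Rightarrow> 'a :: comm_monoid_add"
  assumes "\<And>x y. [x = y] (mod int p) \<Longrightarrow> h x = h y"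
  shows "(\<Sum>x\<in>R. h (c + x)) = (\<Sum>x\<in>R. h x)"
  by (rule sum_residues_reindex[OF assms]) (auto simp: cong_add_lcancel)

lemma sum_residues_scale:
  fixes h :: "int \<Rightarrow> 'a :: comm_monoid_add"
  assumes "\<And>x y. [x = y] (mod int p) \<Longrightarrow> h x = h y" and "\<not> int p dvd c"
  shows "(\<Sum>x\<in>R. h (c * x)) = (\<Sum>x\<in>R. h x)"
proof (rule sum_residues_reindex[OF assms(1)])
  have "coprime c (int p)"
    using prime_imp_coprime[OF prime_int_p assms(2)] by (simp add: coprime_commute)
  then show "[c * x = c * y] (mod int p) \<Longrightarrow> [x = y] (mod int p)" for x y
    by (simp add: cong_mult_lcancel)
qed

section \<open>Primitive roots and power sums\<close>

lemma exists_primroot_int: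
  obtains g :: int where "\<not> int p dvd g" and "\<And>k. [g ^ k = 1] (mod int p) \<longleftrightarrow> (p - 1) dvd k"
proof -
  obtain g where g: "residue_primroot p g"
    using prime_primitive_root_exists[OF _ prime_p] p_gt_2 by auto
  then have "coprime p g" "ord p g = p - 1"
    by (auto simp: residue_primroot_def totient_prime prime_p)
  moreover from this have "[int g ^ k = 1] (mod int p) \<longleftrightarrow> (p - 1) dvd k" for k
    using ord_divides[of g k p] by (metis cong_int_iff of_nat_1 of_nat_power)
  moreover have "\<not> int p dvd int g"
    using \<open>coprime p g\<close> p_gt_2 coprime_absorb_left[of p g] by auto
  ultimately show thesis using that by blast
qed

text \<open>A primitive root works: by Euler's criterion a residue has order dividing
  \<open>(p - 1) div 2\<close>.\<close>

lemma exists_nonresidue: obtains n where "\<chi> n = - 1"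
proof -
  obtain g where g: "\<not> int p dvd g" "\<And>k. [g ^ k = 1] (mod int p) \<longleftrightarrow> (p - 1) dvd k"
    using exists_primroot_int by blast
  have "\<not> (p - 1) dvd (p - 1) div 2"
    using p_gt_2 by (auto dest!: dvd_imp_le)
  then have "\<chi> g \<noteq> 1"
    using cong_Legendre[of g] g(2)[of "(p - 1) div 2"] cong_sym by metis
  then have "\<chi> g = - 1"
    using Legendre_cases[of g] Legendre_eq_0_iff[of g] g(1) by auto
  then show thesis using that by blast
qed

text \<open>If \<open>p - 1\<close> divides \<open>e\<close>, Fermat makes every nonzero term 1.
  Otherwise, scaling the variable by a primitive root \<open>g\<close> multiplies the sum by
  \<open>g ^ e\<close>, which is not 1 modulo \<open>p\<close>.\<close>

lemma sum_powers_cong: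
  assumes "e > 0"
  shows "[(\<Sum>x\<in>R. x ^ e) = (if (p - 1) dvd e then - 1 else 0)] (mod int p)"
proof -
  obtain g where g: "\<not> int p dvd g" "\<And>k. [g ^ k = 1] (mod int p) \<longleftrightarrow> (p - 1) dvd k"
    using exists_primroot_int by blast
  \<comment> \<open>The change of variable is an equality for functions of the residue class, and
    \<open>x ^ e\<close> becomes one only after reduction.\<close>
  have mod_sum: "[(\<Sum>x\<in>R. h x) = (\<Sum>x\<in>R. h x mod int p)] (mod int p)" for h
    by (intro cong_sum) (simp add: cong_def)
  show ?thesis
  proof (cases "(p - 1) dvd e")
    case True
    then obtain k where k: "e = (p - 1) * k" by (rule dvdE)
    have "[x ^ e = 1] (mod int p)" if "x \<in> {1..<int p}" for x
    proof -
      have "\<not> p dvd nat x" using that by (auto dest!: dvd_imp_le)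
      then have "[nat x ^ (p - 1) = 1] (mod p)" by (rule fermat_theorem[OF prime_p])
      then have "[int (nat x ^ (p - 1)) = int 1] (mod int p)" by (simp only: cong_int_iff)
      then have "[x ^ (p - 1) = 1] (mod int p)" using that by simp
      from cong_pow[OF this, of k] show ?thesis by (simp add: k power_mult)
    qed
    then have "[(\<Sum>x\<in>{1..<int p}. x ^ e) = (\<Sum>x\<in>{1..<int p}. 1)] (mod int p)"
      by (rule cong_sum)
    also have "(\<Sum>x\<in>{1..<int p}. 1 :: int) = int p - 1" using p_gt_2 by simp
    also have "[int p - 1 = - 1] (mod int p)" by (simp add: cong_iff_dvd_diff)
    \<comment> \<open>The term at 0 vanishes because \<open>e > 0\<close>.\<close>
    also have "(\<Sum>x\<in>{1..<int p}. x ^ e) = (\<Sum>x\<in>R. x ^ e)"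
      by (rule sum.mono_neutral_left) (use assms in auto)
    finally show ?thesis using True by simp
  next
    case False
    have "(\<Sum>x\<in>R. (g * x) ^ e mod int p) = (\<Sum>x\<in>R. x ^ e mod int p)"
      by (rule sum_residues_scale[OF _ g(1)]) (metis cong_def cong_pow)
    then have "[(\<Sum>x\<in>R. (g * x) ^ e) = (\<Sum>x\<in>R. x ^ e)] (mod int p)"
      using mod_sum cong_trans cong_sym by metis
    then have "[g ^ e * (\<Sum>x\<in>R. x ^ e) = (\<Sum>x\<in>R. x ^ e)] (mod int p)"
      by (simp add: power_mult_distrib sum_distrib_left)
    then have "int p dvd (g ^ e - 1) * (\<Sum>x\<in>R. x ^ e)"
      by (simp add: cong_iff_dvd_diff algebra_simps)
    moreover have "\<not> int p dvd g ^ e - 1"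
      using g(2)[of e] False by (simp add: cong_iff_dvd_diff)
    ultimately have "int p dvd (\<Sum>x\<in>R. x ^ e)"
      using prime_int_p prime_dvd_mult_iff by blast
    then show ?thesis using False by (simp add: cong_0_iff)
  qed
qed

section \<open>Orthogonality of the Legendre symbol\<close>

lemma sum_Legendre: "(\<Sum>x\<in>R. \<chi> x) = 0"
proof -
  obtain n where n: "\<chi> n = - 1" using exists_nonresidue by blast
  then have "\<not> int p dvd n" using Legendre_eq_0_iff[of n] by auto
  \<comment> \<open>Scaling by a nonresidue permutes the residues but negates every term, so the sum
    equals its own negative.\<close>
  then have "(\<Sum>x\<in>R. \<chi> (n * x)) = (\<Sum>x\<in>R. \<chi> x)"
    by (intro sum_residues_scale Legendre_cong)
  then show ?thesis by (simp add: Legendre_mult n sum_negf)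
qed

lemma residues_eq_insert_0: "R = insert 0 {1..<int p}"
  using p_gt_2 by auto

lemma sum_Legendre_square: "(\<Sum>x\<in>R. (\<chi> x)\<^sup>2) = int p - 1"
proof -
  have "(\<Sum>x\<in>{1..<int p}. (\<chi> x)\<^sup>2) = (\<Sum>x\<in>{1..<int p}. 1)"
    by (intro sum.cong) (auto simp: Legendre_square dest: zdvd_imp_le)
  then show ?thesis using p_gt_2 by (simp add: residues_eq_insert_0 Legendre_square)
qed

text \<open>The sum does not depend on \<open>d\<close> as long as \<open>d\<close> is a unit, and the sum over all \<open>d\<close> vanishes.\<close>

lemma sum_Legendre_correlation:
  assumes "\<not> int p dvd d"
  shows "(\<Sum>x\<in>R. \<chi> x * \<chi> (x + d)) = - 1"
proof -
  define J where "J d = (\<Sum>x\<in>R. \<chi> x * \<chi> (x + d))" for d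
  have J1: "J d = J 1" if d: "\<not> int p dvd d" for d
  proof -
    have "J d = (\<Sum>x\<in>R. \<chi> (d * x) * \<chi> (d * x + d))"
      unfolding J_def
      by (rule sum_residues_scale[OF _ d, symmetric])
        (intro arg_cong2[where f = "(*)"] Legendre_cong cong_add cong_refl)
    also have "\<dots> = (\<Sum>x\<in>R. (\<chi> d)\<^sup>2 * (\<chi> x * \<chi> (x + 1)))"
    proof (intro sum.cong refl)
      fix x
      have "d * x + d = d * (x + 1)" by (simp add: algebra_simps)
      then show "\<chi> (d * x) * \<chi> (d * x + d) = (\<chi> d)\<^sup>2 * (\<chi> x * \<chi> (x + 1))"
        by (simp only: Legendre_mult power2_eq_square mult_ac)
    qed
    also have "\<dots> = J 1" by (simp add: Legendre_square d J_def)
    finally show ?thesis .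
  qed
  have "(\<Sum>d\<in>R. J d) = (\<Sum>x\<in>R. \<chi> x * (\<Sum>d\<in>R. \<chi> (x + d)))"
    unfolding J_def sum_distrib_left by (rule sum.swap)
  also have "\<dots> = 0"
  proof -
    have "(\<Sum>d\<in>R. \<chi> (x + d)) = (\<Sum>d\<in>R. \<chi> d)" for x
      by (intro sum_residues_shift Legendre_cong)
    then show ?thesis by (simp add: sum_Legendre)
  qed
  finally have "(\<Sum>d\<in>R. J d) = 0" .
  then have "J 0 + (\<Sum>d\<in>{1..<int p}. J d) = 0" by (simp add: residues_eq_insert_0)
  moreover have "J 0 = int p - 1"
    using sum_Legendre_square by (simp add: J_def power2_eq_square)
  moreover have "(\<Sum>d\<in>{1..<int p}. J d) = (\<Sum>d\<in>{1..<int p}. J 1)"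
    by (intro sum.cong refl J1) (auto dest: zdvd_imp_le)
  ultimately have "(int p - 1) * (1 + J 1) = 0"
    using p_gt_2 by (simp add: algebra_simps)
  then have "J 1 = - 1" using p_gt_2 by auto
  then show ?thesis using J1[OF assms] by (simp add: J_def)
qed

text \<open>The shift \<open>y = b + x\<close> leaves only the difference \<open>c - b\<close>: a
  unit gives the correlation sum, while 0 gives the sum of squares \<open>p - 1\<close>.\<close>

lemma sum_Legendre_product:
  "(\<Sum>x\<in>R. \<chi> (b + x) * \<chi> (c + x)) = (if [b = c] (mod int p) then int p else 0) - 1"
proof -
  have "(\<Sum>x\<in>R. \<chi> (b + x) * \<chi> (c + x)) = (\<Sum>x\<in>R. (\<lambda>y. \<chi> y * \<chi> (y + (c - b))) (b + x))"
    by (simp add: algebra_simps)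
  also have "\<dots> = (\<Sum>x\<in>R. \<chi> x * \<chi> (x + (c - b)))"
    by (rule sum_residues_shift)
      (intro arg_cong2[where f = "(*)"] Legendre_cong cong_add cong_refl)
  also have "\<dots> = (if [b = c] (mod int p) then int p else 0) - 1"
  proof (cases "[b = c] (mod int p)")
    case True
    then have "[x + (c - b) = x] (mod int p)" for x
      by (simp add: cong_iff_dvd_diff dvd_diff_commute)
    then have "\<chi> (x + (c - b)) = \<chi> x" for x
      by (rule Legendre_cong)
    then show ?thesis
      using True sum_Legendre_square by (simp add: power2_eq_square)
  next
    case False
    then have "\<not> int p dvd c - b"
      by (simp add: cong_iff_dvd_diff dvd_diff_commute)
    then show ?thesis using False by (simp add: sum_Legendre_correlation)
  qed
  finally show ?thesis .
qed

text \<open>The character sum of the cubic \<open>x^3 + a x\<close>; for a unit \<open>a\<close> it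
  is minus the trace of Frobenius of the curve \<open>y^2 = x^3 + a x\<close>.\<close>

definition jacobsthal :: "int \<Rightarrow> int" where
  "jacobsthal a = (\<Sum>x\<in>R. \<chi> x * \<chi> (x\<^sup>2 + a))"

lemma jacobsthal_cong:
  assumes "[a = b] (mod int p)" shows "jacobsthal a = jacobsthal b"
  unfolding jacobsthal_def
  by (intro sum.cong refl arg_cong2[where f = "(*)"] Legendre_cong cong_add cong_refl assms)

text \<open>Substituting \<open>t * x\<close> for \<open>x\<close> pulls out \<open>\<chi> t\<close>
  from the first factor and the square \<open>t^2\<close> from the second.\<close>

lemma jacobsthal_scale:
  assumes "\<not> int p dvd t"
  shows "jacobsthal (t\<^sup>2 * a) = \<chi> t * jacobsthal a"
proof -
  have "jacobsthal (t\<^sup>2 * a) = (\<Sum>x\<in>R. \<chi> (t * x) * \<chi> ((t * x)\<^sup>2 + t\<^sup>2 * a))"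
    unfolding jacobsthal_def
    by (rule sum_residues_scale[OF _ assms, symmetric])
      (intro arg_cong2[where f = "(*)"] Legendre_cong cong_add cong_refl cong_pow)
  also have "\<dots> = (\<Sum>x\<in>R. \<chi> t * (\<chi> x * \<chi> (x\<^sup>2 + a)))"
  proof (intro sum.cong refl)
    fix x
    have "(t * x)\<^sup>2 + t\<^sup>2 * a = t\<^sup>2 * (x\<^sup>2 + a)" by (simp add: algebra_simps power2_eq_square)
    then show "\<chi> (t * x) * \<chi> ((t * x)\<^sup>2 + t\<^sup>2 * a) = \<chi> t * (\<chi> x * \<chi> (x\<^sup>2 + a))"
      by (simp only: Legendre_mult Legendre_of_square[OF assms] mult_ac mult_1_left)
  qed
  also have "\<dots> = \<chi> t * jacobsthal a" by (simp add: jacobsthal_def sum_distrib_left)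
  finally show ?thesis .
qed

text \<open>Scaling changes only the sign, so the square depends only on the class of
  \<open>a\<close> modulo squares of units. Multipliers on both sides avoid inverses modulo
  \<open>p\<close>.\<close>

lemma jacobsthal_square_eq:
  assumes "[s\<^sup>2 * a = t\<^sup>2 * b] (mod int p)" "\<not> int p dvd s" "\<not> int p dvd t"
  shows "(jacobsthal a)\<^sup>2 = (jacobsthal b)\<^sup>2"
proof -
  have "(\<chi> s * jacobsthal a)\<^sup>2 = (\<chi> t * jacobsthal b)\<^sup>2"
    using jacobsthal_cong[OF assms(1)] by (simp add: jacobsthal_scale assms(2,3))
  then show ?thesis by (simp add: power_mult_distrib Legendre_square assms(2,3))
qed

lemma jacobsthal_0: "jacobsthal 0 = 0"
proof -
  have "\<chi> x * \<chi> (x\<^sup>2) = \<chi> x" for x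
    using Legendre_cases[of x] by (auto simp: Legendre_mult power2_eq_square)
  then have "jacobsthal 0 = (\<Sum>x\<in>R. \<chi> x)" by (simp only: jacobsthal_def add_0_right)
  then show ?thesis by (simp only: sum_Legendre)
qed

end

section \<open>Gauss's congruence for the central binomial coefficient\<close>

text \<open>\<open>p\<close> divides \<open>(a d - b c)(- a d - b c)\<close>, so after a possible
  change of sign of \<open>d\<close> it divides \<open>a d - b c\<close>. The identity
  \<open>p^2 = (a c + b d)^2 + (a d - b c)^2\<close> then forces one of the two squares to
  vanish.\<close>

lemma sum_two_squares_unique:
  fixes a b c d :: int
  assumes p: "prime p" "odd p" "p = a\<^sup>2 + b\<^sup>2" "p = c\<^sup>2 + d\<^sup>2" and odd: "odd a" "odd c"
  shows "a\<^sup>2 = c\<^sup>2"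
proof -
  have main: "a\<^sup>2 = c\<^sup>2" if dvd: "p dvd a * d - b * c" and d: "p = c\<^sup>2 + d\<^sup>2" for d
  proof -
    have bb: "b * b = p - a * a" and dd: "d * d = p - c * c"
      using p(3) d by (simp_all add: power2_eq_square)
    have "(a * d)\<^sup>2 - (b * c)\<^sup>2 = (a * a) * (d * d) - (b * b) * (c * c)"
      by (simp add: power2_eq_square)
    then have diff: "(a * d)\<^sup>2 - (b * c)\<^sup>2 = p * (a\<^sup>2 - c\<^sup>2)"
      unfolding bb dd by (simp add: power2_eq_square algebra_simps)
    from dvd obtain k where k: "a * d - b * c = p * k" by (rule dvdE)
    have "p\<^sup>2 = (a\<^sup>2 + b\<^sup>2) * (c\<^sup>2 + d\<^sup>2)"
      unfolding p(3)[symmetric] d[symmetric] by (rule power2_eq_square)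
    then have "p\<^sup>2 = (a * c + b * d)\<^sup>2 + (a * d - b * c)\<^sup>2"
      by (simp add: power2_eq_square algebra_simps)
    then have sq: "p\<^sup>2 * (1 - k\<^sup>2) = (a * c + b * d)\<^sup>2"
      by (simp add: k power_mult_distrib algebra_simps)
    have p0: "p > 0" using p(1) by (rule prime_gt_0_int)
    show ?thesis
    proof (cases "k = 0")
      case True
      then have "a * d = b * c" using k by simp
      then have "p * (a\<^sup>2 - c\<^sup>2) = 0" using diff by simp
      then show ?thesis using p0 by simp
    next
      \<comment> \<open>Now \<open>a c = - b d\<close>, which leads to \<open>p = a^2 + c^2\<close>,
        a sum of two odd squares and hence even.\<close>
      case False
      then have "1 \<le> k\<^sup>2" by (simp add: int_one_le_iff_zero_less)
      then have "p\<^sup>2 * (1 - k\<^sup>2) \<le> 0" by (simp add: mult_nonneg_nonpos)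
      then have "(a * c + b * d)\<^sup>2 \<le> 0" using sq by simp
      then have "a * c = - (b * d)" by simp
      then have "(a * c)\<^sup>2 = (b * d)\<^sup>2" by simp
      then have "(a * a) * (c * c) = (b * b) * (d * d)" by (simp add: power2_eq_square mult_ac)
      then have "p * (p - a\<^sup>2 - c\<^sup>2) = 0"
        unfolding bb dd by (simp add: power2_eq_square algebra_simps)
      then have "p = a\<^sup>2 + c\<^sup>2" using p0 by simp
      then have "even p" using odd by simp
      then show ?thesis using p(2) by simp
    qed
  qed
  have "(a * d - b * c) * (a * - d - b * c) = - (p * (a\<^sup>2 - c\<^sup>2))"
  proof -
    have bb: "b * b = p - a * a" and dd: "d * d = p - c * c"
      using p(3,4) by (simp_all add: power2_eq_square)
    have "(a * d - b * c) * (a * - d - b * c) = (b * b) * (c * c) - (a * a) * (d * d)"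
      by (simp add: algebra_simps)
    then show ?thesis
      unfolding bb dd by (simp add: power2_eq_square algebra_simps)
  qed
  then have "p dvd (a * d - b * c) * (a * - d - b * c)" by simp
  then have "p dvd a * d - b * c \<or> p dvd a * - d - b * c"
    using p(1) prime_dvd_mult_iff by blast
  then show ?thesis using main[of d] main[of "- d"] p(4) by auto
qed

section \<open>Jacobsthal sums for primes of the form 4f + 1\<close>

locale prime_1_mod_4 =
  fixes p f :: nat
  assumes p: "prime p" "p = 4 * f + 1"
begin

sublocale odd_prime_modulus p
proof
  show "prime p" by (fact p(1))
  have "f \<noteq> 0"
  proof
    assume "f = 0"
    then show False using p by simp
  qed
  then show "2 < p" using p(2) by simp
qed

lemma half_eq: "(p - 1) div 2 = 2 * f"
  using p(2) by simp

lemma Legendre_minus_1: "\<chi> (- 1) = 1"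
proof (rule cong_small_eq)
  show "[\<chi> (- 1) = 1] (mod int p)"
    using cong_Legendre[of "- 1"] by (simp only: half_eq) simp
  show "\<bar>\<chi> (- 1)\<bar> \<le> 1"
    using Legendre_cases[of "- 1"] by auto
qed simp

lemma Legendre_uminus: "\<chi> (- x) = \<chi> x"
  using Legendre_mult[of "- 1" x] by (simp add: Legendre_minus_1)

text \<open>With \<open>i^2 = -1\<close> one has \<open>(1 + i)^2 = 2 i\<close>, and Euler's
  criterion for this square gives \<open>1 = 2^(2f) i^(2f)\<close>, where
  \<open>i^(2f) = (-1)^f\<close>.\<close>

lemma two_power_cong: "[2 ^ (2 * f) = (- 1) ^ f] (mod int p)"
proof -
  obtain i where i: "[i\<^sup>2 = - 1] (mod int p)"
    using Legendre_eq_1D[OF Legendre_minus_1] by blast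
  have ndvd: "\<not> int p dvd 1 + i"
  proof
    assume "int p dvd 1 + i"
    then have "[i = - 1] (mod int p)" by (simp add: cong_iff_dvd_diff add.commute)
    from cong_pow[OF this, of 2] have "[i\<^sup>2 = 1] (mod int p)" by simp
    with i have "[1 = - 1] (mod int p)" using cong_trans cong_sym by metis
    then have "int p dvd 2" by (simp add: cong_iff_dvd_diff)
    then show False using p_gt_2 zdvd_imp_le[of "int p" 2] by simp
  qed
  have "[(1 + i)\<^sup>2 = 2 * i] (mod int p)"
  proof -
    have "(1 + i)\<^sup>2 - 2 * i = i\<^sup>2 - (- 1)" by (simp add: power2_eq_square algebra_simps)
    then show ?thesis using i by (simp add: cong_iff_dvd_diff)
  qed
  from cong_pow[OF this, of "2 * f"]
  have *: "[((1 + i)\<^sup>2) ^ (2 * f) = 2 ^ (2 * f) * i ^ (2 * f)] (mod int p)"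
    by (simp only: power_mult_distrib)
  have i2f: "[i ^ (2 * f) = (- 1) ^ f] (mod int p)"
    using cong_pow[OF i, of f] by (simp add: power_mult)
  have "[\<chi> ((1 + i)\<^sup>2) = ((1 + i)\<^sup>2) ^ (2 * f)] (mod int p)"
    using cong_Legendre[of "(1 + i)\<^sup>2"] by (simp only: half_eq)
  with * have "[\<chi> ((1 + i)\<^sup>2) = 2 ^ (2 * f) * i ^ (2 * f)] (mod int p)"
    by (rule cong_trans[rotated])
  also have "[2 ^ (2 * f) * i ^ (2 * f) = 2 ^ (2 * f) * (- 1) ^ f] (mod int p)"
    by (intro cong_mult cong_refl i2f)
  finally have "[1 = 2 ^ (2 * f) * (- 1) ^ f] (mod int p)"
    by (simp only: Legendre_of_square[OF ndvd])
  from cong_scalar_right[OF this, of "(- 1) ^ f"] show ?thesis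
    by (simp add: cong_sym mult.assoc flip: power_mult_distrib)
qed

text \<open>Pairing \<open>x\<close> with \<open>p - x\<close> exchanges the two halves of the
  nonzero residues.\<close>

lemma sum_residues_even:
  fixes h :: "int \<Rightarrow> int"
  assumes h: "\<And>x y. [x = y] (mod int p) \<Longrightarrow> h x = h y"
    and even: "\<And>x. h (- x) = h x"
  shows "(\<Sum>x\<in>R. h x) = h 0 + 2 * (\<Sum>x=1..2 * int f. h x)"
proof -
  have "(\<Sum>x=2 * int f + 1..4 * int f. h x) = (\<Sum>x=1..2 * int f. h x)"
  proof (rule sum.reindex_bij_witness[of _ "\<lambda>x. int p - x" "\<lambda>x. int p - x"])
    fix x
    show "h (int p - x) = h x"
      using h[of "int p - x" "- x"] even by (simp add: cong_iff_dvd_diff)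
  qed (use p(2) in auto)
  moreover have "R = insert 0 ({1..2 * int f} \<union> {2 * int f + 1..4 * int f})"
    using p(2) by auto
  moreover have "{1..2 * int f} \<inter> {2 * int f + 1..4 * int f} = {}" by auto
  ultimately show ?thesis by (simp add: sum.union_disjoint)
qed

lemma jacobsthal_even: "even (jacobsthal a)"
proof -
  have "jacobsthal a = \<chi> 0 * \<chi> (0\<^sup>2 + a) + 2 * (\<Sum>x=1..2 * int f. \<chi> x * \<chi> (x\<^sup>2 + a))"
    unfolding jacobsthal_def
    by (rule sum_residues_even)
      (auto simp: Legendre_uminus intro!: arg_cong2[where f = "(*)"] Legendre_cong cong_add cong_pow)
  then show ?thesis by (simp add: Legendre_eq_0_iff[THEN iffD2])
qed

text \<open>Sum the product \<open>(1 - \<chi> x)(1 - \<chi> (x^2 - 1))\<close>: each nonzero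
  residue contributes a multiple of 4 and comes paired with its negative, giving 8. Expanded, the
  total is \<open>p + 1\<close> plus the Jacobsthal sum.\<close>

lemma jacobsthal_minus_1_mod_8: "[jacobsthal (- 1) = - (int p + 1)] (mod 8)"
proof -
  define h where "h x = (1 - \<chi> x) * (1 - \<chi> (x\<^sup>2 - 1))" for x
  have h4: "4 dvd h x" if x: "x \<in> {1..2 * int f}" for x
  proof (cases "int p dvd x\<^sup>2 - 1")
    \<comment> \<open>The second factor is only 1 at \<open>x = 1\<close> or \<open>x = -1\<close>,
      but there the first factor is 0.\<close>
    case True
    have "x\<^sup>2 - 1 = (x - 1) * (x + 1)" by (simp add: power2_eq_square algebra_simps)
    with True have "[x = 1] (mod int p) \<or> [x = - 1] (mod int p)"
      using prime_dvd_mult_iff[OF prime_int_p, of "x - 1" "x + 1"] by (simp add: cong_iff_dvd_diff)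
    then have "\<chi> x = 1" using Legendre_cong Legendre_1 Legendre_minus_1 by metis
    then show ?thesis by (simp add: h_def)
  next
    case False
    have "\<not> int p dvd x" using x p(2) by (auto dest: zdvd_imp_le)
    then show ?thesis
      using False Legendre_cases[of x] Legendre_cases[of "x\<^sup>2 - 1"]
        Legendre_eq_0_iff[of x] Legendre_eq_0_iff[of "x\<^sup>2 - 1"]
      by (auto simp: h_def)
  qed
  have "(\<Sum>x\<in>R. h x) = h 0 + 2 * (\<Sum>x=1..2 * int f. h x)"
  proof (rule sum_residues_even)
    fix x y assume "[x = y] (mod int p)"
    then show "h x = h y"
      unfolding h_def
      by (intro arg_cong2[where f = "(*)"] arg_cong2[where f = "(-)"] Legendre_cong cong_diff cong_pow refl cong_refl)
  qed (simp add: h_def Legendre_uminus)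
  moreover have "h 0 = 0" by (simp add: h_def Legendre_minus_1)
  moreover have "4 dvd (\<Sum>x=1..2 * int f. h x)" by (intro dvd_sum h4)
  ultimately have "8 dvd (\<Sum>x\<in>R. h x)" by auto
  moreover have "(\<Sum>x\<in>R. \<chi> (x\<^sup>2 - 1)) = - 1"
  proof -
    have "\<chi> (x\<^sup>2 - 1) = \<chi> (- 1 + x) * \<chi> (1 + x)" for x
    proof -
      have "x\<^sup>2 - 1 = (- 1 + x) * (1 + x)" by (simp add: power2_eq_square algebra_simps)
      then show ?thesis by (simp only: Legendre_mult)
    qed
    moreover have "\<not> [- 1 = 1] (mod int p)"
      using p_gt_2 by (auto simp: cong_iff_dvd_diff dest: zdvd_imp_le)
    ultimately show ?thesis using sum_Legendre_product[of "- 1" 1] by simp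
  qed
  moreover have "(\<Sum>x\<in>R. h x)
      = (\<Sum>x\<in>R. 1) - (\<Sum>x\<in>R. \<chi> x) - (\<Sum>x\<in>R. \<chi> (x\<^sup>2 - 1)) + jacobsthal (- 1)"
    unfolding jacobsthal_def sum_subtractf[symmetric] sum.distrib[symmetric]
    by (intro sum.cong) (simp_all add: h_def algebra_simps)
  ultimately have "8 dvd jacobsthal (- 1) + (int p + 1)"
    by (simp add: sum_Legendre add_ac)
  then show ?thesis by (simp add: cong_iff_dvd_diff algebra_simps)
qed

text \<open>Among the exponents \<open>2f + 2j\<close> with \<open>j\<close> from 0 to
  \<open>2f\<close>, only \<open>4f\<close> is a multiple of \<open>p - 1\<close>. So the power sums
  retain just the middle binomial coefficient, with factor -1.\<close>

lemma jacobsthal_minus_1_cong: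
  "[jacobsthal (- 1) = - ((- 1) ^ f * int ((2 * f) choose f))] (mod int p)"
proof -
  have f0: "f > 0" using p by (cases f) auto
  have summand: "[\<chi> x * \<chi> (x\<^sup>2 + - 1) = (\<Sum>j\<le>2 * f. int ((2 * f) choose j) * (- 1) ^ j * x ^ (2 * f + 2 * j))] (mod int p)" for x
  proof -
    have "[\<chi> x * \<chi> (x\<^sup>2 + - 1) = x ^ (2 * f) * (x\<^sup>2 + - 1) ^ (2 * f)] (mod int p)"
      using cong_mult[OF cong_Legendre cong_Legendre] by (simp only: half_eq)
    also have "x ^ (2 * f) * (x\<^sup>2 + - 1) ^ (2 * f)
        = (\<Sum>j\<le>2 * f. int ((2 * f) choose j) * (- 1) ^ j * x ^ (2 * f + 2 * j))"
      unfolding binomial_ring sum_distrib_left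
    proof (intro sum.cong refl)
      fix j assume "j \<in> {..2 * f}"
      then have sign: "(- 1 :: int) ^ (2 * f - j) = (- 1) ^ j" by (simp add: neg_one_power_add_eq_neg_one_power_diff minus_one_power_iff)
      then show "x ^ (2 * f) * (of_nat ((2 * f) choose j) * (x\<^sup>2) ^ j * (- 1) ^ (2 * f - j))
          = int ((2 * f) choose j) * (- 1) ^ j * x ^ (2 * f + 2 * j)"
        unfolding sign power_add power_mult by (simp only: mult_ac)
    qed
    finally show ?thesis .
  qed
  have "[jacobsthal (- 1)
      = (\<Sum>x\<in>R. \<Sum>j\<le>2 * f. int ((2 * f) choose j) * (- 1) ^ j * x ^ (2 * f + 2 * j))] (mod int p)"
    unfolding jacobsthal_def by (intro cong_sum summand)
  also have "(\<Sum>x\<in>R. \<Sum>j\<le>2 * f. int ((2 * f) choose j) * (- 1) ^ j * x ^ (2 * f + 2 * j))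
      = (\<Sum>j\<le>2 * f. int ((2 * f) choose j) * (- 1) ^ j * (\<Sum>x\<in>R. x ^ (2 * f + 2 * j)))"
    unfolding sum_distrib_left by (rule sum.swap)
  also have "[(\<Sum>j\<le>2 * f. int ((2 * f) choose j) * (- 1) ^ j * (\<Sum>x\<in>R. x ^ (2 * f + 2 * j)))
      = (\<Sum>j\<le>2 * f. int ((2 * f) choose j) * (- 1) ^ j * (if j = f then - 1 else 0))] (mod int p)"
  proof (intro cong_sum cong_mult cong_refl)
    fix j assume j: "j \<in> {..2 * f}"
    have "(p - 1) dvd 2 * f + 2 * j \<longleftrightarrow> j = f"
    proof
      assume "(p - 1) dvd 2 * f + 2 * j"
      then obtain k where k: "2 * f + 2 * j = 4 * f * k" using p(2) by (auto elim: dvdE)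
      then have "f + j = 2 * f * k" by simp
      \<comment> \<open>\<open>k = 0\<close> contradicts \<open>f > 0\<close>, and
        \<open>k \<ge> 2\<close> would give \<open>j \<ge> 3 f\<close>.\<close>
      moreover have "k = 1"
      proof (rule ccontr)
        assume "k \<noteq> 1"
        then consider "k = 0" | "k \<ge> 2" by linarith
        then show False
        proof cases
          case 2
          then have "2 * f * 2 \<le> 2 * f * k" by (intro mult_le_mono2)
          moreover have "j \<le> 2 * f" using j by simp
          ultimately show False using \<open>f + j = 2 * f * k\<close> f0 by linarith
        qed (use \<open>f + j = 2 * f * k\<close> f0 in simp)
      qed
      ultimately show "j = f" by simp
    qed (use p(2) in simp)
    then show "[(\<Sum>x\<in>R. x ^ (2 * f + 2 * j)) = (if j = f then - 1 else 0)] (mod int p)"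
      using sum_powers_cong[of "2 * f + 2 * j"] f0 by simp
  qed
  also have "(\<Sum>j\<le>2 * f. int ((2 * f) choose j) * (- 1) ^ j * (if j = f then - 1 else 0))
      = (\<Sum>j\<le>2 * f. if j = f then - ((- 1) ^ f * int ((2 * f) choose f)) else 0)"
    by (intro sum.cong) auto
  also have "\<dots> = - ((- 1) ^ f * int ((2 * f) choose f))" by simp
  finally show ?thesis .
qed

text \<open>Expand the square and sum over \<open>a\<close> first. Orthogonality leaves the pairs
  with \<open>y = x\<close> or \<open>y = - x\<close>, and both have the same symbol because -1 is a
  residue.\<close>

lemma sum_jacobsthal_square: "(\<Sum>a\<in>R. (jacobsthal a)\<^sup>2) = 2 * int p * (int p - 1)"
proof -
  \<comment> \<open>The diagonal part of the orthogonality relation; its constant part -1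
    contributes a product of two vanishing symbol sums.\<close>
  define E where "E x y = (if [x\<^sup>2 = y\<^sup>2] (mod int p) then int p else 0)" for x y
  have fibre: "\<chi> x * (\<Sum>y\<in>R. \<chi> y * E x y) = 2 * int p * (\<chi> x)\<^sup>2" if x: "x \<in> R" for x
  proof (cases "x = 0")
    case True
    then show ?thesis by (simp add: Legendre_eq_0_iff[THEN iffD2])
  next
    case False
    have "x \<noteq> int p - x" using p(2) by presburger
    have roots: "y \<in> {x, int p - x}" if y: "y \<in> R" and "[x\<^sup>2 = y\<^sup>2] (mod int p)" for y
    proof -
      have "x\<^sup>2 - y\<^sup>2 = (x - y) * (x + y)" by (simp add: power2_eq_square algebra_simps)
      then have "int p dvd x - y \<or> int p dvd x + y"
        using that(2) prime_dvd_mult_iff[OF prime_int_p, of "x - y" "x + y"]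
        by (simp add: cong_iff_dvd_diff)
      then have "[y = x] (mod int p) \<or> [y = int p - x] (mod int p)"
      proof
        assume "int p dvd x + y"
        then have "int p dvd y - (int p - x)"
          using dvd_diff[of "int p" "x + y" "int p"] by (simp add: algebra_simps)
        then show ?thesis by (simp add: cong_iff_dvd_diff)
      qed (simp add: cong_iff_dvd_diff dvd_diff_commute)
      then show ?thesis using cong_R_eq[of y x] cong_R_eq[of y "int p - x"] x y False by auto
    qed
    have "\<chi> y * E x y = 0" if "y \<in> R - {x, int p - x}" for y
    proof -
      have "\<not> [x\<^sup>2 = y\<^sup>2] (mod int p)" using roots[of y] that by blast
      then show ?thesis by (simp add: E_def)
    qed
    then have "(\<Sum>y\<in>R. \<chi> y * E x y) = (\<Sum>y\<in>{x, int p - x}. \<chi> y * E x y)"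
      using x False by (intro sum.mono_neutral_right) auto
    also have "\<dots> = \<chi> x * E x x + \<chi> (int p - x) * E x (int p - x)"
      using \<open>x \<noteq> int p - x\<close> by simp
    also have "\<chi> (int p - x) = \<chi> x"
      using Legendre_cong[of "int p - x" "- x"] by (simp add: cong_iff_dvd_diff Legendre_uminus)
    also have "E x (int p - x) = int p"
    proof -
      have "x\<^sup>2 - (int p - x)\<^sup>2 = int p * (2 * x - int p)" by (simp add: power2_eq_square algebra_simps)
      then show ?thesis by (simp add: E_def cong_iff_dvd_diff)
    qed
    finally show ?thesis by (simp add: E_def power2_eq_square)
  qed
  have "(\<Sum>a\<in>R. (jacobsthal a)\<^sup>2)
      = (\<Sum>a\<in>R. \<Sum>x\<in>R. \<Sum>y\<in>R. \<chi> x * \<chi> y * (\<chi> (x\<^sup>2 + a) * \<chi> (y\<^sup>2 + a)))"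
    by (simp only: jacobsthal_def power2_eq_square[of "sum _ _"] sum_product mult_ac)
  also have "\<dots> = (\<Sum>x\<in>R. \<Sum>y\<in>R. \<Sum>a\<in>R. \<chi> x * \<chi> y * (\<chi> (x\<^sup>2 + a) * \<chi> (y\<^sup>2 + a)))"
    by (rule trans[OF sum.swap]) (intro sum.cong refl sum.swap)
  also have "\<dots> = (\<Sum>x\<in>R. \<Sum>y\<in>R. \<chi> x * \<chi> y * (E x y - 1))"
    by (simp only: sum_distrib_left[symmetric] sum_Legendre_product E_def)
  also have "\<dots> = (\<Sum>x\<in>R. \<chi> x * (\<Sum>y\<in>R. \<chi> y * E x y)) - (\<Sum>x\<in>R. \<chi> x) * (\<Sum>y\<in>R. \<chi> y)"
    by (simp add: sum_product sum_distrib_left algebra_simps flip: sum_subtractf)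
  also have "\<dots> = 2 * int p * (int p - 1)"
    by (simp add: fibre sum_Legendre sum_Legendre_square flip: sum_distrib_left)
  finally show ?thesis .
qed

text \<open>The squared sum takes one value on residues, the class of -1, and one on nonresidues,
  the class of \<open>n\<close>. Each class has \<open>(p - 1) / 2\<close> elements, so the second
  moment determines the sum of the two values.\<close>

lemma sum_jacobsthal_squares:
  assumes n: "\<chi> n = - 1"
  shows "(jacobsthal (- 1))\<^sup>2 + (jacobsthal n)\<^sup>2 = 4 * int p"
proof -
  let ?A = "(jacobsthal (- 1))\<^sup>2" and ?B = "(jacobsthal n)\<^sup>2"
  \<comment> \<open>The weights \<open>1 + \<chi> a\<close> and \<open>1 - \<chi> a\<close> are
    twice the indicators of the two classes, and their symbol parts cancel in the sum.\<close>
  have summand: "2 * (jacobsthal a)\<^sup>2 = (1 + \<chi> a) * ?A + (1 - \<chi> a) * ?B" if a: "a \<in> {1..<int p}" for a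
  proof -
    have "\<not> int p dvd a" using a by (auto dest: zdvd_imp_le)
    then consider "\<chi> a = 1" | "\<chi> a = - 1" using Legendre_cases[of a] Legendre_eq_0_iff[of a] by blast
    then show ?thesis
    proof cases
      case 1
      then obtain t where t: "[t\<^sup>2 = - a] (mod int p)" "\<not> int p dvd t"
        using Legendre_eq_1D[of "- a"] by (auto simp: Legendre_uminus)
      then have "[1\<^sup>2 * a = t\<^sup>2 * - 1] (mod int p)"
        using cong_minus_minus_iff[of "t\<^sup>2" "- a"] by (simp add: cong_sym_eq)
      then have "(jacobsthal a)\<^sup>2 = ?A"
        by (rule jacobsthal_square_eq) (use t p_gt_2 in auto)
      then show ?thesis using 1 by simp
    next
      case 2
      then obtain t where t: "[t\<^sup>2 = n * a] (mod int p)" "\<not> int p dvd t"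
        using Legendre_eq_1D[of "n * a"] n by (auto simp: Legendre_mult)
      \<comment> \<open>For a nonresidue \<open>a\<close> the product \<open>n * a\<close> is a
        square \<open>t^2\<close>; multiplying by \<open>n\<close> shows \<open>a\<close> and
        \<open>n\<close> in the same class.\<close>
      have "[n\<^sup>2 * a = t\<^sup>2 * n] (mod int p)"
        using cong_scalar_right[OF t(1), of n] by (simp add: power2_eq_square mult_ac cong_sym)
      then have "(jacobsthal a)\<^sup>2 = ?B"
        by (rule jacobsthal_square_eq) (use t n Legendre_eq_0_iff[of n] in auto)
      then show ?thesis using 2 by simp
    qed
  qed
  have "2 * (2 * int p * (int p - 1)) = (\<Sum>a\<in>R. 2 * (jacobsthal a)\<^sup>2)"
    by (simp only: sum_jacobsthal_square sum_distrib_left[symmetric])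
  also have "\<dots> = (\<Sum>a\<in>{1..<int p}. 2 * (jacobsthal a)\<^sup>2)"
    using p_gt_2 by (simp add: residues_eq_insert_0 jacobsthal_0)
  also have "\<dots> = (\<Sum>a\<in>{1..<int p}. ?A + ?B + \<chi> a * (?A - ?B))"
    by (intro sum.cong refl) (use summand in \<open>simp add: algebra_simps\<close>)
  also have "\<dots> = (int p - 1) * (?A + ?B) + (\<Sum>a\<in>{1..<int p}. \<chi> a) * (?A - ?B)"
    using p_gt_2 by (simp add: sum.distrib sum_distrib_right)
  also have "(\<Sum>a\<in>{1..<int p}. \<chi> a) = 0"
    using sum_Legendre p_gt_2 by (simp add: residues_eq_insert_0 Legendre_eq_0_iff[THEN iffD2])
  finally have "(int p - 1) * (?A + ?B) = (int p - 1) * (4 * int p)"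
    by (simp add: algebra_simps)
  then show ?thesis using p_gt_2 by simp
qed

text \<open>The value of the Jacobsthal sum at \<open>-1\<close> modulo \<open>8\<close> fixes the sign of \<open>x\<close>.\<close>

theorem central_binomial_cong_two_squares:
  fixes x y :: int
  assumes xy: "int p = x\<^sup>2 + 4 * y\<^sup>2" and x: "[x = 1] (mod 4)"
  shows "[int ((2 * f) choose f) = 2 * x] (mod int p)"
proof -
  obtain n where n: "\<chi> n = - 1" using exists_nonresidue by blast
  obtain u where u: "jacobsthal (- 1) = 2 * u" using jacobsthal_even by (rule evenE)
  obtain v where v: "jacobsthal n = 2 * v" using jacobsthal_even by (rule evenE)
  \<comment> \<open>The sign is chosen so that \<open>2 * w\<close> is congruent to the central
    binomial coefficient; it remains to identify \<open>w\<close> with \<open>x\<close>.\<close>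
  define w where "w = - ((- 1) ^ f * u)"
  have "int p = u\<^sup>2 + v\<^sup>2"
    using sum_jacobsthal_squares[OF n] by (simp add: u v power_mult_distrib)
  moreover have "w\<^sup>2 = u\<^sup>2"
    by (simp add: w_def power_mult_distrib power_even_eq flip: power_mult)
  ultimately have pw: "int p = w\<^sup>2 + v\<^sup>2" by simp
  have "8 dvd 2 * u + (int p + 1)"
    using jacobsthal_minus_1_mod_8 by (simp add: u cong_iff_dvd_diff algebra_simps)
  \<comment> \<open>Halving, with \<open>p + 1 = 4 f + 2\<close>: modulo 4, \<open>u\<close> is -1
    for even \<open>f\<close> and 1 for odd \<open>f\<close>, so \<open>w\<close> is 1 in both
    cases.\<close>
  then have u4: "4 dvd u + (2 * int f + 1)" using p(2) by presburger
  have w4: "[w = 1] (mod 4)"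
  proof (cases "even f")
    case True
    then have "w = - u" by (simp add: w_def)
    with u4 True show ?thesis by (simp add: cong_iff_dvd_diff) presburger
  next
    case False
    then have "w = u" by (simp add: w_def)
    with u4 False show ?thesis by (simp add: cong_iff_dvd_diff) presburger
  qed
  have "x mod 4 = 1" "w mod 4 = 1" using x w4 by (simp_all add: cong_def)
  then have "odd x" "odd w" by presburger+
  then have "x\<^sup>2 = w\<^sup>2"
    using sum_two_squares_unique[OF prime_int_p _ _ pw, of x "2 * y"] xy p(2)
    by (simp add: power_mult_distrib)
  then have "x = w \<or> x = - w" by (simp add: power2_eq_iff)
  with \<open>x mod 4 = 1\<close> \<open>w mod 4 = 1\<close> have "x = w" by presburger
  have "[- ((- 1) ^ f) * (2 * u) = - ((- 1) ^ f) * - ((- 1) ^ f * int ((2 * f) choose f))] (mod int p)"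
    using jacobsthal_minus_1_cong by (intro cong_mult cong_refl) (simp add: u)
  moreover have "- ((- 1) ^ f) * - ((- 1) ^ f * int ((2 * f) choose f)) = int ((2 * f) choose f)"
    by (simp add: mult.assoc[symmetric] flip: power_mult_distrib)
  moreover have "- ((- 1) ^ f) * (2 * u) = 2 * x"
    using \<open>x = w\<close> by (simp add: w_def)
  ultimately have "[2 * x = int ((2 * f) choose f)] (mod int p)" by (simp only:)
  then show ?thesis by (rule cong_sym)
qed

end

section \<open>Congruences between rationals\<close>

text \<open>Reduction of a \<open>p\<close>-integral rational to its class modulo \<open>p\<close>.
  Any denominator prime to \<open>p\<close> may serve, not only the reduced one, so a common
  denominator of a sum can be used directly.\<close>

definition local_residue :: "nat \<Rightarrow> rat \<Rightarrow> int \<Rightarrow> bool" where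
  "local_residue p r z \<longleftrightarrow>
     (\<exists>D A. D \<noteq> 0 \<and> coprime D (int p) \<and> of_int D * r = of_int A \<and> [A = D * z] (mod int p))"

text \<open>The denominator in lowest terms divides \<open>D\<close>, so it inherits coprimality to
  \<open>p\<close>.\<close>

lemma fraction_in_local_ints:
  assumes "coprime D (int p)" and "D \<noteq> 0"
  shows "of_int A / of_int D \<in> local_ints p"
proof -
  obtain n d where nd: "quotient_of (of_int A / of_int D) = (n, d)" by fastforce
  have "of_int A / of_int D = (of_int n / of_int d :: rat)" using quotient_of_div[OF nd] .
  moreover have "d > 0" using quotient_of_denom_pos[OF nd] .
  ultimately have "(of_int (A * d) :: rat) = of_int (n * D)"
    using assms(2) by (simp add: field_simps)
  then have "A * d = n * D" by (simp only: of_int_eq_iff)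
  then have "d dvd n * D" by (metis dvd_triv_right)
  then have "d dvd D"
    using quotient_of_coprime[OF nd] by (simp add: coprime_dvd_mult_right_iff coprime_commute)
  then have "coprime d (int p)" using assms(1) coprime_divisors dvd_refl by blast
  then show ?thesis by (simp add: local_ints_def nd)
qed

lemma local_congI:
  assumes "local_residue p r z" "local_residue p s w" "[z = w] (mod int p)"
  shows "local_cong p r s"
proof -
  obtain D A where D: "D \<noteq> 0" "coprime D (int p)" "of_int D * r = of_int A" "[A = D * z] (mod int p)"
    using assms(1) by (auto simp: local_residue_def)
  obtain E B where E: "E \<noteq> 0" "coprime E (int p)" "of_int E * s = of_int B" "[B = E * w] (mod int p)"
    using assms(2) by (auto simp: local_residue_def)
  have r: "r = of_int A / of_int D" and s: "s = of_int B / of_int E"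
    using D(1,3) E(1,3) by (simp_all add: field_simps)
  have "[A * E = (D * z) * E] (mod int p)" by (intro cong_mult D(4) cong_refl)
  moreover have "[(D * z) * E = (E * w) * D] (mod int p)"
    using cong_mult[OF cong_refl assms(3), of "D * E"] by (simp only: mult_ac)
  moreover have "[(E * w) * D = B * D] (mod int p)"
    by (intro cong_mult cong_sym[OF E(4)] cong_refl)
  ultimately have "[A * E = B * D] (mod int p)" using cong_trans by blast
  then obtain k where k: "A * E - B * D = int p * k"
    by (auto simp: cong_iff_dvd_diff elim: dvdE)
  have "r - s = of_int (A * E - B * D) / of_int (D * E)"
    using D(1) E(1) by (simp add: r s field_simps)
  then have "r - s = of_nat p * (of_int k / of_int (D * E))"
    by (simp add: k)
  moreover have "of_int k / of_int (D * E) \<in> local_ints p"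
    by (rule fraction_in_local_ints) (use D E in simp_all)
  moreover have "r \<in> local_ints p" "s \<in> local_ints p"
    unfolding r s by (intro fraction_in_local_ints D E)+
  ultimately show ?thesis unfolding local_cong_def by blast
qed

lemma local_residue_of_int: "local_residue p (of_int z) z"
  unfolding local_residue_def by (intro exI[of _ 1] exI[of _ z]) simp

lemma local_residue_mult_int:
  assumes "local_residue p r z"
  shows "local_residue p (of_int e * r) (e * z)"
proof -
  obtain D A where D: "D \<noteq> 0" "coprime D (int p)" "of_int D * r = of_int A" "[A = D * z] (mod int p)"
    using assms by (auto simp: local_residue_def)
  have "of_int D * (of_int e * r) = of_int (e * A)"
    unfolding of_int_mult D(3)[symmetric] by (simp only: mult_ac)
  moreover have "[e * A = D * (e * z)] (mod int p)"
    using cong_mult[OF cong_refl D(4), of e] by (simp only: mult_ac)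
  ultimately show ?thesis unfolding local_residue_def using D(1,2) by blast
qed

lemma local_residue_cong:
  assumes "local_residue p r z" "[z = w] (mod int p)"
  shows "local_residue p r w"
  using assms unfolding local_residue_def by (meson cong_trans cong_scalar_left)

text \<open>Multiplying by \<open>c ^ (p - 1)\<close> clears all denominators, and modulo
  \<open>p\<close> the division by \<open>c ^ n\<close> becomes multiplication by
  \<open>c' ^ n\<close>.\<close>

lemma local_residue_G_sum:
  assumes p: "prime p" "p = 2 * m + 1"
    and c: "c \<noteq> 0" "[c * c' = 1] (mod int p)"
  shows "local_residue p (G_sum p (of_int c)) (sq_binom_sum m (16 * c') * (1 - 16 * c') ^ m)"
proof (rule local_residue_cong[OF _ cong_G_sum_factor[OF p]])
  define A where "A = (\<Sum>n=0..p - 1. int (G n) * c ^ (p - 1 - n))"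
  have split: "c ^ (p - 1) = c ^ (p - 1 - n) * c ^ n" if "n \<in> {0..p - 1}" for n
    using that by (simp only: power_add[symmetric] le_add_diff_inverse2 atLeastAtMost_iff)
  have "coprime c (int p)"
    using c(2) coprime_iff_invertible_int by blast
  then have "coprime (c ^ (p - 1)) (int p)" by simp
  moreover have "of_int (c ^ (p - 1)) * G_sum p (of_int c) = of_int A"
    unfolding G_sum_def A_def sum_distrib_left of_int_sum
  proof (intro sum.cong refl)
    fix n assume n: "n \<in> {0..p - 1}"
    show "of_int (c ^ (p - 1)) * (of_nat (G n) / of_int c ^ n)
        = (of_int (int (G n) * c ^ (p - 1 - n)) :: rat)"
      unfolding split[OF n] using c(1) by simp
  qed
  moreover have "[A = c ^ (p - 1) * (\<Sum>n=0..p - 1. int (G n) * c' ^ n)] (mod int p)"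
    unfolding A_def sum_distrib_left
  proof (rule cong_sum)
    fix n assume n: "n \<in> {0..p - 1}"
    have eq: "c ^ (p - 1) * (int (G n) * c' ^ n) = int (G n) * c ^ (p - 1 - n) * (c * c') ^ n"
      unfolding split[OF n] by (simp only: power_mult_distrib mult_ac)
    have "[int (G n) * c ^ (p - 1 - n) * 1 ^ n = int (G n) * c ^ (p - 1 - n) * (c * c') ^ n] (mod int p)"
      by (intro cong_mult cong_pow cong_refl cong_sym[OF c(2)])
    then show "[int (G n) * c ^ (p - 1 - n) = c ^ (p - 1) * (int (G n) * c' ^ n)] (mod int p)"
      unfolding eq by (simp only: power_one mult_1_right)
  qed
  ultimately show "local_residue p (G_sum p (of_int c)) (\<Sum>n=0..p - 1. int (G n) * c' ^ n)"
    unfolding local_residue_def using c(1) by (intro exI[of _ "c ^ (p - 1)"] exI[of _ A]) simp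
qed

text \<open>For the bases -16, 8 and 32 the argument \<open>16 c'\<close> is -1, 2 and 1/2, and
  \<open>1 - 16 c'\<close> is 2, -1 and 1/2 modulo \<open>p\<close>.\<close>

lemma local_residue_G_sums:
  assumes p: "prime p" "p = 2 * m + 1"
  shows "local_residue p (G_sum p (- 16)) (2 ^ m * sq_binom_sum m (- 1))"
    and "local_residue p (G_sum p 8) ((- 1) ^ m * sq_binom_sum m (- 1))"
    and "local_residue p (G_sum p 32) (sq_binom_sum m (- 1))"
proof -
  have "coprime 2 (int p)" using p(2) by simp
  \<comment> \<open>\<open>h\<close> is the inverse of 2; the inverses of the three bases are
    \<open>- (h ^ 4)\<close>, \<open>h ^ 3\<close> and \<open>h ^ 5\<close>.\<close>
  then obtain h where h: "[2 * h = 1] (mod int p)"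
    using cong_solve_coprime_int by blast
  have h_pow: "[2 ^ k * h ^ k = 1] (mod int p)" for k
    using cong_pow[OF h, of k] by (simp add: power_mult_distrib)
  let ?K = "sq_binom_sum m (- 1)"

  have "[- 16 * - (h ^ 4) = 1] (mod int p)" using h_pow[of 4] by simp
  from local_residue_G_sum[OF p _ this]
  have "local_residue p (G_sum p (- 16)) (sq_binom_sum m (16 * - (h ^ 4)) * (1 - 16 * - (h ^ 4)) ^ m)"
    by simp
  moreover have h16: "[16 * - (h ^ 4) = - 1] (mod int p)"
    using h_pow[of 4] cong_minus_minus_iff[of "16 * h ^ 4" 1] by simp
  have "[sq_binom_sum m (16 * - (h ^ 4)) * (1 - 16 * - (h ^ 4)) ^ m
      = ?K * (1 - - 1) ^ m] (mod int p)"
    by (intro cong_mult cong_pow cong_diff cong_refl sq_binom_sum_cong h16)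
  ultimately show "local_residue p (G_sum p (- 16)) (2 ^ m * ?K)"
    by (auto intro: local_residue_cong simp: mult.commute)

  have "[8 * h ^ 3 = 1] (mod int p)" using h_pow[of 3] by simp
  from local_residue_G_sum[OF p _ this]
  have "local_residue p (G_sum p 8) (sq_binom_sum m (16 * h ^ 3) * (1 - 16 * h ^ 3) ^ m)"
    by simp
  moreover have h16: "[16 * h ^ 3 = 2] (mod int p)"
    using cong_scalar_left[OF h_pow[of 3], of 2] by simp
  have "[sq_binom_sum m (16 * h ^ 3) * (1 - 16 * h ^ 3) ^ m = ?K * (1 - 2) ^ m] (mod int p)"
    by (intro cong_mult cong_pow cong_diff cong_refl h16
        cong_trans[OF sq_binom_sum_cong[OF h16] sq_binom_sum_two_cong[OF p]])
  ultimately show "local_residue p (G_sum p 8) ((- 1) ^ m * ?K)"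
    by (auto intro: local_residue_cong simp: mult.commute)

  have "[32 * h ^ 5 = 1] (mod int p)" using h_pow[of 5] by simp
  from local_residue_G_sum[OF p _ this]
  have res32: "local_residue p (G_sum p 32) (sq_binom_sum m (16 * h ^ 5) * (1 - 16 * h ^ 5) ^ m)"
    by simp
  have h16: "[16 * h ^ 5 = h] (mod int p)"
    using cong_scalar_right[OF h_pow[of 4], of h] by (simp add: mult.assoc flip: power_Suc2)
  have one_minus: "[1 - 16 * h ^ 5 = h] (mod int p)"
  proof -
    have "[1 - 16 * h ^ 5 = 2 * h - h] (mod int p)"
      by (intro cong_diff h16 cong_sym[OF h])
    then show ?thesis by simp
  qed
  have "\<not> p dvd 2"
    using p(2) prime_gt_1_nat[OF p(1)] by (auto dest: dvd_imp_le)
  then have "[int (2 ^ (p - 1)) = int 1] (mod int p)"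
    unfolding cong_int_iff by (rule fermat_theorem[OF p(1)])
  moreover have "p - 1 = m + m" using p(2) by simp
  ultimately have fermat: "[2 ^ (m + m) = 1] (mod int p)" by simp
  have "[sq_binom_sum m (16 * h ^ 5) * (1 - 16 * h ^ 5) ^ m = sq_binom_sum m h * h ^ m * 1] (mod int p)"
    unfolding mult_1_right by (intro cong_mult cong_pow one_minus sq_binom_sum_cong[OF h16])
  \<comment> \<open>Insert \<open>2 ^ (2 * m)\<close>, which is 1 by Fermat: one factor
    \<open>2 ^ m\<close> reverses the polynomial from \<open>h\<close> to 2, the other cancels
    \<open>h ^ m\<close>.\<close>
  also have "[sq_binom_sum m h * h ^ m * 1 = sq_binom_sum m h * h ^ m * 2 ^ (m + m)] (mod int p)"
    by (intro cong_mult cong_refl cong_sym[OF fermat])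
  also have "sq_binom_sum m h * h ^ m * 2 ^ (m + m) = (sq_binom_sum m h * 2 ^ m) * (2 ^ m * h ^ m)"
    by (simp only: power_add mult_ac)
  also have "[(sq_binom_sum m h * 2 ^ m) * (2 ^ m * h ^ m) = sq_binom_sum m 2 * 1] (mod int p)"
    by (intro cong_mult h_pow sq_binom_sum_inverse) (use h in \<open>simp add: mult.commute\<close>)
  also have "sq_binom_sum m 2 * 1 = sq_binom_sum m 2" by simp
  also have "[sq_binom_sum m 2 = ?K] (mod int p)" by (rule sq_binom_sum_two_cong[OF p])
  finally show "local_residue p (G_sum p 32) ?K" by (rule local_residue_cong[OF res32])
qed

theorem theorem2p8:
  fixes p :: nat
  assumes "prime p" and "odd p"
  shows "([p = 1] (mod 4) \<longrightarrow>
           (\<forall>x y :: int. int p = x\<^sup>2 + 4 * y\<^sup>2 \<and> [x = 1] (mod 4) \<longrightarrow>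
              local_cong p (G_sum p (- 16)) ((- 1) ^ ((p - 1) div 4) * G_sum p 8) \<and>
              local_cong p ((- 1) ^ ((p - 1) div 4) * G_sum p 8)
                           ((- 1) ^ ((p - 1) div 4) * G_sum p 32) \<and>
              local_cong p ((- 1) ^ ((p - 1) div 4) * G_sum p 32) (of_int (2 * x)))) \<and>
         ([p = 3] (mod 4) \<longrightarrow>
            local_cong p (G_sum p (- 16)) 0 \<and>
            local_cong p (G_sum p 8) 0 \<and>
            local_cong p (G_sum p 32) 0)"
proof (intro conjI impI allI)
  obtain m where m: "p = 2 * m + 1" using \<open>odd p\<close> by (rule oddE)
  note residues = local_residue_G_sums[OF \<open>prime p\<close> m]
  {
    fix x y :: int
    assume "[p = 1] (mod 4)" and xy: "int p = x\<^sup>2 + 4 * y\<^sup>2 \<and> [x = 1] (mod 4)"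
    define f where "f = (p - 1) div 4"
    have "p mod 4 = 1" using \<open>[p = 1] (mod 4)\<close> by (simp add: cong_def)
    then have f: "p = 4 * f + 1" unfolding f_def by presburger
    then interpret prime_1_mod_4 p f using \<open>prime p\<close> by unfold_locales
    \<comment> \<open>\<open>C\<close> is the common residue of all three signed sums; Gauss's
      congruence enters only when it is compared with \<open>2 * x\<close>.\<close>
    define C where "C = int ((2 * f) choose f)"
    have m_eq: "m = 2 * f" using m f by simp
    have m_even: "(- 1 :: int) ^ m = 1" by (simp add: m_eq)
    have K: "sq_binom_sum m (- 1) = (- 1) ^ f * C"
      by (simp add: sq_binom_sum_minus_one m_eq C_def)
    have sign: "(- 1 :: int) ^ f * ((- 1) ^ f * C) = C"
      by (simp add: mult.assoc[symmetric] flip: power_mult_distrib)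
    have C: "[C = 2 * x] (mod int p)"
      unfolding C_def using xy by (intro central_binomial_cong_two_squares) auto
    \<comment> \<open>The factor \<open>2 ^ m\<close> is \<open>(- 1) ^ f\<close> modulo
      \<open>p\<close> and absorbs the sign in \<open>sq_binom_sum m (- 1)\<close>, so the sum for
      -16 carries no sign.\<close>
    have "[2 ^ m * sq_binom_sum m (- 1) = (- 1) ^ f * ((- 1) ^ f * C)] (mod int p)"
      unfolding m_eq K[unfolded m_eq] by (intro cong_mult cong_refl two_power_cong)
    then have r16: "local_residue p (G_sum p (- 16)) C"
      using residues(1) local_residue_cong unfolding sign by blast
    have r8: "local_residue p ((- 1) ^ f * G_sum p 8) C"
      using local_residue_mult_int[OF residues(2), of "(- 1) ^ f"] sign by (simp add: K m_even)
    have r32: "local_residue p ((- 1) ^ f * G_sum p 32) C"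
      using local_residue_mult_int[OF residues(3), of "(- 1) ^ f"] sign by (simp add: K)
    show "local_cong p (G_sum p (- 16)) ((- 1) ^ ((p - 1) div 4) * G_sum p 8)"
      unfolding f_def[symmetric] by (rule local_congI[OF r16 r8 cong_refl])
    show "local_cong p ((- 1) ^ ((p - 1) div 4) * G_sum p 8) ((- 1) ^ ((p - 1) div 4) * G_sum p 32)"
      unfolding f_def[symmetric] by (rule local_congI[OF r8 r32 cong_refl])
    show "local_cong p ((- 1) ^ ((p - 1) div 4) * G_sum p 32) (of_int (2 * x))"
      unfolding f_def[symmetric] by (rule local_congI[OF r32 local_residue_of_int C])
  next
    assume "[p = 3] (mod 4)"
    then have "p mod 4 = 3" by (simp add: cong_def)
    \<comment> \<open>For odd \<open>m\<close> the value at -1 is zero, and it is a factor of all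
      three residues.\<close>
    then have "odd m" using m by presburger
    then have K: "sq_binom_sum m (- 1) = 0" by (simp add: sq_binom_sum_minus_one)
    have "local_cong p r 0" if "local_residue p r 0" for r
      using local_congI[OF that local_residue_of_int[of p 0] cong_refl] by simp
    then show "local_cong p (G_sum p (- 16)) 0" "local_cong p (G_sum p 8) 0" "local_cong p (G_sum p 32) 0"
      using residues by (simp_all add: K)
  }
qed

end
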